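(* Let $D$ be an infinite, connected, distance-transitive, weakly descendant-homogeneous digraph of finite out-valency $m>0$ with no directed cycles, and let $\Gamma=\Gamma(\alpha)$ be its descendant subdigraph. Then the following are equivalent: (a) $D$ has property $Z$; (b) the reachability relation on the edges of $D$ is not universal; (c) $\Gamma$ does not satisfy P3, i.e. there is an integer $i\ge 1$ with $|\Gamma^i(\alpha)|\ge|\Gamma^{i+1}(\alpha)|$.
   Context: A digraph $D$ has vertex set and edge set $E(D)\subseteq D\times D$, no loops; subdigraphs are induced. An $s$-arc ($s\ge0$) from $u$ to $v$ is a sequence $u_0\dots u_s$ with $u_0=u$, $u_s=v$, $(u_i,u_{i+1})\in E(D)$, and $u_{i-1}\neq u_{i+1}$ for $0<i<s$. $D^s(u)$ is the set of vertices reachable from $u$ by an $s$-arc, $\mathrm{desc}(u)=\bigcup_{s\ge0}D^s(u)$, $\mathrm{desc}(X)=\bigcup_{x\in X}\mathrm{desc}(x)$. Distance-transitive: for each $s\ge0$, $\mathrm{Aut}(D)$ is transitive on pairs $(u,v)$ with an $s$-arc but no shorter arc from $u$ to $v$. Weakly descendant-homogeneous: $D$ is vertex transitive and for finite vertex sets $X,Y$ and any isomorphism $f$ between the induced subdigraphs on $\mathrm{desc}(X)$ and $\mathrm{desc}(Y)$ there is an automorphism of $D$ agreeing with $f$ on $X$. A directed cycle is $u_0,\dots,u_n=u_0$ ($n\ge1$) with consecutive edges. The descendant subdigraph $\Gamma=\Gamma(\alpha)$ is the induced subdigraph on $\mathrm{desc}(\alpha)$ for a vertex $\alpha$ (independent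 of $\alpha$ up to isomorphism by vertex transitivity), and $\Gamma^i(\alpha)=D^i(\alpha)$. Property P3 for $\Gamma$: $|\Gamma^i(\alpha)|<|\Gamma^{i+1}(\alpha)|$ for every integer $i\ge1$. Property $Z$: there is a surjection $f$ from the vertices onto $\mathbb{Z}$ with $f(v)=f(u)+1$ for each edge $(u,v)$. An alternating walk is a sequence $x_0x_1\dots x_n$ of vertices such that either $(x_{2i-1},x_{2i})$ and $(x_{2i+1},x_{2i})$ are edges for all relevant $i$, or $(x_{2i},x_{2i-1})$ and $(x_{2i},x_{2i+1})$ are edges for all relevant $i$. For edges $e,e'$, $e$ reaches $e'$ if there is an alternating walk $x_0\dots x_n$ with $e=(x_0,x_1)$ and $e'=(x_{n-1},x_n)$ or $e'=(x_n,x_{n-1})$; this reachability relation is an equivalence relation on $E(D)$, and it is universal if it has a single class. *)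

theory Defs
  imports "Graph_Theory.Digraph_Component"
begin

definition induced_subdigraph :: "'a pair_pre_digraph \<Rightarrow> 'a set \<Rightarrow> 'a pair_pre_digraph" where
  "induced_subdigraph D X =
     \<lparr>pverts = X, parcs = {(u, v). (u, v) \<in> parcs D \<and> u \<in> X \<and> v \<in> X}\<rparr>"

definition is_isomorphism ::
    "'a pair_pre_digraph \<Rightarrow> 'b pair_pre_digraph \<Rightarrow> ('a \<Rightarrow> 'b) \<Rightarrow> bool" where
  "is_isomorphism D D' f \<longleftrightarrow>
     bij_betw f (pverts D) (pverts D') \<and>
     (\<forall>u\<in>pverts D. \<forall>v\<in>pverts D. (u, v) \<in> parcs D \<longleftrightarrow> (f u, f v) \<in> parcs D')"

abbreviation is_automorphism :: "'a pair_pre_digraph \<Rightarrow> ('a \<Rightarrow> 'a) \<Rightarrow> bool" where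
  "is_automorphism D \<equiv> is_isomorphism D D"

text \<open>An \<open>s\<close>-arc is given by its vertices \<open>p 0, \<dots>, p s\<close>; values of \<open>p\<close> beyond \<open>s\<close> are irrelevant.
  The same convention is used for directed cycles and alternating walks.\<close>

definition is_s_arc :: "'a pair_pre_digraph \<Rightarrow> nat \<Rightarrow> (nat \<Rightarrow> 'a) \<Rightarrow> 'a \<Rightarrow> 'a \<Rightarrow> bool" where
  "is_s_arc D s p u v \<longleftrightarrow>
     p 0 = u \<and> p s = v \<and> (\<forall>i\<le>s. p i \<in> pverts D) \<and>
     (\<forall>i<s. (p i, p (i + 1)) \<in> parcs D) \<and>
     (\<forall>i. 0 < i \<and> i < s \<longrightarrow> p (i - 1) \<noteq> p (i + 1))"

text \<open>\<open>arc_sphere D s u\<close> is the set $D^s(u)$; it contains the endpoints of all \<open>s\<close>-arcs from \<open>u\<close>,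
  including those which can also be reached by a shorter arc.\<close>

definition arc_sphere :: "'a pair_pre_digraph \<Rightarrow> nat \<Rightarrow> 'a \<Rightarrow> 'a set" where
  "arc_sphere D s u = {v. \<exists>p. is_s_arc D s p u v}"

definition desc :: "'a pair_pre_digraph \<Rightarrow> 'a \<Rightarrow> 'a set" where
  "desc D u = (\<Union>s. arc_sphere D s u)"

definition desc_set :: "'a pair_pre_digraph \<Rightarrow> 'a set \<Rightarrow> 'a set" where
  "desc_set D X = (\<Union>x\<in>X. desc D x)"

definition vertex_transitive :: "'a pair_pre_digraph \<Rightarrow> bool" where
  "vertex_transitive D \<longleftrightarrow>
     (\<forall>u\<in>pverts D. \<forall>v\<in>pverts D. \<exists>g. is_automorphism D g \<and> g u = v)"

definition at_distance :: "'a pair_pre_digraph \<Rightarrow> nat \<Rightarrow> 'a \<Rightarrow> 'a \<Rightarrow> bool" where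
  "at_distance D s u v \<longleftrightarrow> v \<in> arc_sphere D s u \<and> (\<forall>t<s. v \<notin> arc_sphere D t u)"

definition distance_transitive :: "'a pair_pre_digraph \<Rightarrow> bool" where
  "distance_transitive D \<longleftrightarrow>
     (\<forall>s u v u' v'. at_distance D s u v \<and> at_distance D s u' v' \<longrightarrow>
        (\<exists>g. is_automorphism D g \<and> g u = u' \<and> g v = v'))"

definition weakly_descendant_homogeneous :: "'a pair_pre_digraph \<Rightarrow> bool" where
  "weakly_descendant_homogeneous D \<longleftrightarrow>
     vertex_transitive D \<and>
     (\<forall>X Y f. finite X \<and> X \<subseteq> pverts D \<and> finite Y \<and> Y \<subseteq> pverts D \<and>
        is_isomorphism (induced_subdigraph D (desc_set D X))
                       (induced_subdigraph D (desc_set D Y)) f \<longrightarrow>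
        (\<exists>g. is_automorphism D g \<and> (\<forall>x\<in>X. g x = f x)))"

definition has_directed_cycle :: "'a pair_pre_digraph \<Rightarrow> bool" where
  "has_directed_cycle D \<longleftrightarrow>
     (\<exists>(n::nat) p. n \<ge> 1 \<and> p n = p 0 \<and> (\<forall>i<n. (p i, p (i + 1)) \<in> parcs D))"

definition descendant_subdigraph :: "'a pair_pre_digraph \<Rightarrow> 'a \<Rightarrow> 'a pair_pre_digraph" where
  "descendant_subdigraph D \<alpha> = induced_subdigraph D (desc D \<alpha>)"

definition P3 :: "'a pair_pre_digraph \<Rightarrow> 'a \<Rightarrow> bool" where
  "P3 \<Gamma> \<alpha> \<longleftrightarrow> (\<forall>i\<ge>1. card (arc_sphere \<Gamma> i \<alpha>) < card (arc_sphere \<Gamma> (i + 1) \<alpha>))"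

definition property_Z :: "'a pair_pre_digraph \<Rightarrow> bool" where
  "property_Z D \<longleftrightarrow>
     (\<exists>f :: 'a \<Rightarrow> int. f ` pverts D = UNIV \<and> (\<forall>(u, v)\<in>parcs D. f v = f u + 1))"

definition alternating_walk :: "'a pair_pre_digraph \<Rightarrow> nat \<Rightarrow> (nat \<Rightarrow> 'a) \<Rightarrow> bool" where
  "alternating_walk D n x \<longleftrightarrow>
     (\<forall>i\<le>n. x i \<in> pverts D) \<and>
     ((\<forall>i. (1 \<le> 2 * i \<and> 2 * i \<le> n \<longrightarrow> (x (2 * i - 1), x (2 * i)) \<in> parcs D) \<and>
           (2 * i + 1 \<le> n \<longrightarrow> (x (2 * i + 1), x (2 * i)) \<in> parcs D)) \<or>
      (\<forall>i. (1 \<le> 2 * i \<and> 2 * i \<le> n \<longrightarrow> (x (2 * i), x (2 * i - 1)) \<in> parcs D) \<and>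
           (2 * i + 1 \<le> n \<longrightarrow> (x (2 * i), x (2 * i + 1)) \<in> parcs D)))"

definition reachability :: "'a pair_pre_digraph \<Rightarrow> (('a \<times> 'a) \<times> ('a \<times> 'a)) set" where
  "reachability D =
     {(e, e'). e \<in> parcs D \<and> e' \<in> parcs D \<and>
        (\<exists>n x. n \<ge> 1 \<and> alternating_walk D n x \<and> e = (x 0, x 1) \<and>
               (e' = (x (n - 1), x n) \<or> e' = (x n, x (n - 1))))}"

definition reachability_universal :: "'a pair_pre_digraph \<Rightarrow> bool" where
  "reachability_universal D \<longleftrightarrow> (\<exists>C. parcs D // reachability D = {C})"

text \<open>$\Gamma^i(\alpha) = D^i(\alpha)$ for $\Gamma = \Gamma(\alpha)$, so it does not matter in which of
  the two digraphs the cardinalities in \<open>P3\<close> are computed.\<close>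

lemma arc_sphere_descendant_subdigraph:
  "arc_sphere (descendant_subdigraph D \<alpha>) s \<alpha> = arc_sphere D s \<alpha>"
proof -
  have "is_s_arc (descendant_subdigraph D \<alpha>) s p \<alpha> v" if p: "is_s_arc D s p \<alpha> v" for p v
  proof -
    have "p i \<in> desc D \<alpha>" if "i \<le> s" for i
    proof -
      have "is_s_arc D i p \<alpha> (p i)"
        using p that by (auto simp: is_s_arc_def)
      then show ?thesis by (auto simp: desc_def arc_sphere_def)
    qed
    then show ?thesis
      using p by (auto simp: is_s_arc_def descendant_subdigraph_def induced_subdigraph_def)
  qed
  moreover have "is_s_arc D s p \<alpha> v" if "is_s_arc (descendant_subdigraph D \<alpha>) s p \<alpha> v" for p v
  proof -
    have "desc D \<alpha> \<subseteq> pverts D"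
      by (auto simp: desc_def arc_sphere_def is_s_arc_def)
    then show ?thesis
      using that by (auto simp: is_s_arc_def descendant_subdigraph_def induced_subdigraph_def)
  qed
  ultimately show ?thesis
    unfolding arc_sphere_def by blast
qed

end

theory Submission
  imports Defs
begin

text \<open>Acyclicity and distance transitivity make the spheres around a vertex pairwise disjoint, so
  the in-degree of a vertex within a descendant set depends only on its depth, and it is
  non-decreasing in the depth. If P3 fails, sphere sizes are eventually constant; then
  \<open>sphere (k + 1) u = sphere k x\<close> for each edge \<open>(u, x)\<close> and all large \<open>k\<close>, which yields a level function.

  If P3 holds, these in-degrees are bounded by \<open>m\<close> and hence constant from some depth \<open>N\<close> on, so a
  descendant of \<open>u\<close> at depth \<open>N + 1\<close> that is not below a given out-neighbour \<open>x\<close> has no descendant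
  in common with \<open>x\<close>. Descendant homogeneity lets one move disjoint descendant
  sets independently of each other. Repeatedly replacing a vertex by a sibling in general position,
  one finds two edges in one reachability class whose heads \<open>x\<close>, \<open>y\<close> have disjoint
  descendant sets. An automorphism fixing \<open>x\<close> and moving \<open>y\<close> to one of its out-neighbours shows
  that the edges into \<open>y\<close> and out of \<open>y\<close> are in the same class, whence the relation is universal.\<close>

section \<open>Spheres and descendant sets in an acyclic digraph\<close>

locale distance_transitive_dag =
  fixes D :: "'a pair_pre_digraph" and m :: nat
  assumes wf: "pair_wf_digraph D"
    and conn: "Digraph_Component.connected (with_proj D)"
    and dist_trans: "distance_transitive D"
    and m_pos: "m > 0"
    and out: "\<forall>v\<in>pverts D. finite (out_arcs (with_proj D) v) \<and> out_degree (with_proj D) v = m"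
    and no_cycle: "\<not> has_directed_cycle D"
begin

abbreviation V where "V \<equiv> pverts D"
abbreviation E where "E \<equiv> parcs D"
abbreviation aut where "aut \<equiv> is_automorphism D"

text \<open>The set $D^n(u)$ as a relational power: acyclicity already rules out backtracking, so
  plain walks suffice (\<open>arc_sphere_conv\<close>).\<close>

definition sphere :: "nat \<Rightarrow> 'a \<Rightarrow> 'a set" where
  "sphere n u = (E ^^ n) `` {u}"

definition below :: "'a \<Rightarrow> 'a set" where
  "below u = E\<^sup>* `` {u}"

lemma E_V: "(u, v) \<in> E \<Longrightarrow> u \<in> V \<and> v \<in> V"
  using wf by (auto simp: pair_wf_digraph_def)

lemma out_arcs_conv: "out_arcs (with_proj D) v = Pair v ` (E `` {v})"
  by (auto simp: out_arcs_def)

lemma finite_out: "v \<in> V \<Longrightarrow> finite (E `` {v})"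
  using out by (auto simp: out_arcs_conv dest: finite_imageD intro: inj_onI)

lemma card_out: "v \<in> V \<Longrightarrow> card (E `` {v}) = m"
  using out by (simp add: out_arcs_conv out_degree_def card_image inj_on_def)

lemma ex_out: "v \<in> V \<Longrightarrow> \<exists>w. (v, w) \<in> E"
  using card_out[of v] m_pos by (cases "E `` {v} = {}") auto

lemma E_acyclic: "acyclic E"
proof (rule acyclicI, intro allI notI)
  fix x assume "(x, x) \<in> E\<^sup>+"
  then obtain n where "n > 0" "(x, x) \<in> E ^^ n" by (auto simp: trancl_power)
  then obtain p where "p 0 = x" "p n = x" "\<forall>i<n. (p i, p (Suc i)) \<in> E"
    by (auto simp: relpow_fun_conv)
  with \<open>n > 0\<close> have "has_directed_cycle D"
    unfolding has_directed_cycle_def by (intro exI[of _ n] exI[of _ p]) auto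
  with no_cycle show False by simp
qed

lemma connected_rtrancl:
  assumes "u \<in> V" "v \<in> V"
  shows "(u, v) \<in> (E \<union> E\<inverse>)\<^sup>*"
proof -
  have "parcs (mk_symmetric (with_proj D)) = E \<union> E\<inverse>"
    by (auto simp: parcs_mk_symmetric)
  moreover have "reachable (with_proj (mk_symmetric (with_proj D))) u v"
    using conn assms by (auto simp: connected_def strongly_connected_def)
  ultimately show ?thesis
    using reachable_rtranclI by fastforce
qed

lemma relpow_V: "(u, v) \<in> E ^^ n \<Longrightarrow> u \<in> V \<Longrightarrow> v \<in> V"
  by (cases n) (auto dest: E_V)

lemma mem_sphere: "v \<in> sphere n u \<longleftrightarrow> (u, v) \<in> E ^^ n"
  by (simp add: sphere_def)

lemma sphere_V: "u \<in> V \<Longrightarrow> sphere n u \<subseteq> V"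
  by (auto simp: mem_sphere relpow_V)

lemma sphere_0 [simp]: "sphere 0 u = {u}"
  by (auto simp: mem_sphere)

lemma sphere_Suc_0: "sphere (Suc 0) u = E `` {u}"
  by (auto simp: mem_sphere)

lemma sphere_Suc: "sphere (Suc n) u = E `` sphere n u"
  by (auto simp: sphere_def)

lemma sphere_Suc': "sphere (Suc n) u = (\<Union>x \<in> E `` {u}. sphere n x)"
proof -
  have "sphere (Suc n) u = (E O E ^^ n) `` {u}" by (simp add: sphere_def relpow_commute)
  then show ?thesis by (auto simp: sphere_def)
qed

lemma sphere_sphere: "v \<in> sphere k u \<Longrightarrow> sphere n v \<subseteq> sphere (k + n) u"
  by (auto simp: mem_sphere relpow_add)

lemma sphere_add_obtain:
  assumes "v \<in> sphere (k + n) u"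
  obtains w where "w \<in> sphere k u" "v \<in> sphere n w"
  using assms by (auto simp: mem_sphere relpow_add)

lemma finite_sphere: "u \<in> V \<Longrightarrow> finite (sphere n u)"
proof (induction n)
  case (Suc n)
  have "sphere (Suc n) u = (\<Union>w \<in> sphere n u. E `` {w})"
    by (auto simp: sphere_Suc)
  with Suc sphere_V finite_out show ?case by auto
qed simp

lemma sphere_nonempty: "u \<in> V \<Longrightarrow> sphere n u \<noteq> {}"
proof (induction n)
  case (Suc n)
  then obtain w where "w \<in> sphere n u" "w \<in> V" using sphere_V by blast
  with ex_out[of w] show ?case by (auto simp: sphere_Suc)
qed simp

lemma below_spheres: "below u = (\<Union>n. sphere n u)"
  by (auto simp: below_def mem_sphere rtrancl_power)

lemma below_V: "u \<in> V \<Longrightarrow> below u \<subseteq> V"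
  using sphere_V by (auto simp: below_spheres)

lemma below_refl: "u \<in> below u"
  by (auto simp: below_def)

lemma sphere_below: "sphere n u \<subseteq> below u"
  by (auto simp: below_spheres)

lemma below_mono: "v \<in> below u \<Longrightarrow> below v \<subseteq> below u"
  by (auto simp: below_def)

section \<open>Action of automorphisms on spheres and descendant sets\<close>

lemma aut_V: "aut g \<Longrightarrow> u \<in> V \<Longrightarrow> g u \<in> V"
  by (auto simp: is_isomorphism_def bij_betw_def)

lemma aut_inj: "aut g \<Longrightarrow> inj_on g V"
  by (auto simp: is_isomorphism_def bij_betw_def)

lemma aut_E: "aut g \<Longrightarrow> (u, v) \<in> E \<Longrightarrow> (g u, g v) \<in> E"
  using E_V[of u v] by (simp add: is_isomorphism_def)

lemma aut_id: "aut id"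
  by (auto simp: is_isomorphism_def)

lemma aut_inv:
  assumes "aut g"
  shows "aut (inv_into V g)" "\<And>u. u \<in> V \<Longrightarrow> inv_into V g (g u) = u"
    "\<And>u. u \<in> V \<Longrightarrow> g (inv_into V g u) = u"
proof -
  have b: "bij_betw g V V" and e: "\<And>u v. u \<in> V \<Longrightarrow> v \<in> V \<Longrightarrow> (u, v) \<in> E \<longleftrightarrow> (g u, g v) \<in> E"
    using assms by (auto simp: is_isomorphism_def)
  show 1: "inv_into V g (g u) = u" if "u \<in> V" for u
    using b that by (rule bij_betw_inv_into_left)
  show 2: "g (inv_into V g u) = u" if "u \<in> V" for u
    using b that by (rule bij_betw_inv_into_right)
  have b': "bij_betw (inv_into V g) V V" using b by (rule bij_betw_inv_into)
  then have "inv_into V g u \<in> V" if "u \<in> V" for u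
    using that by (auto simp: bij_betw_def)
  with b' 2 e show "aut (inv_into V g)"
    by (simp add: is_isomorphism_def)
qed

lemma aut_relpow: "aut g \<Longrightarrow> (u, v) \<in> E ^^ n \<Longrightarrow> (g u, g v) \<in> E ^^ n"
  by (induction n arbitrary: v) (auto dest: aut_E)

lemma aut_sphere:
  assumes "aut g" "u \<in> V"
  shows "sphere n (g u) = g ` sphere n u"
proof
  show "g ` sphere n u \<subseteq> sphere n (g u)"
    using assms by (auto simp: mem_sphere aut_relpow)
  show "sphere n (g u) \<subseteq> g ` sphere n u"
  proof
    fix w assume w: "w \<in> sphere n (g u)"
    then have "w \<in> V" using sphere_V aut_V assms by blast
    moreover have "inv_into V g w \<in> sphere n u"
      using w aut_relpow[OF aut_inv(1)[OF assms(1)], of "g u" w n] aut_inv(2)[OF assms]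
      by (simp add: mem_sphere)
    ultimately show "w \<in> g ` sphere n u"
      using aut_inv(3)[OF assms(1)] by (metis imageI)
  qed
qed

lemma aut_below: "aut g \<Longrightarrow> u \<in> V \<Longrightarrow> below (g u) = g ` below u"
  by (simp add: below_spheres aut_sphere image_UN)

section \<open>Arcs as plain walks, and disjointness of spheres\<close>

lemma walk_no_backtrack:
  fixes i s :: nat
  assumes "\<forall>i<s. (p i, p (i + 1)) \<in> E" "0 < i" "i < s"
  shows "p (i - 1) \<noteq> p (i + 1)"
proof
  assume eq: "p (i - 1) = p (i + 1)"
  obtain k where k: "i = Suc k" using assms(2) by (cases i) auto
  have "(p k, p i) \<in> E" "(p i, p k) \<in> E"
    using assms(1)[rule_format, of k] assms(1)[rule_format, of i] assms(3) eq by (simp_all add: k)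
  then have "(p i, p i) \<in> E\<^sup>+" by (rule trancl_into_trancl2[OF _ r_into_trancl, rotated])
  with E_acyclic show False by (simp add: acyclic_def)
qed

text \<open>A backtracking step would close a directed 2-cycle, so every walk is an arc. The
  assumption on \<open>u\<close> matters for \<open>s = 0\<close>, where an arc must consist of a
  vertex of \<open>D\<close>.\<close>

lemma arc_sphere_conv:
  assumes "u \<in> V"
  shows "arc_sphere D s u = sphere s u"
proof -
  have "is_s_arc D s p u v" if p: "p 0 = u" "p s = v" "\<forall>i<s. (p i, p (i + 1)) \<in> E" for p v
  proof -
    have "p i \<in> V" if "i \<le> s" for i
      using p(3)[rule_format, of "i - 1"] E_V that p(1) assms by (cases i) auto
    with p walk_no_backtrack[OF p(3)] show ?thesis
      by (auto simp: is_s_arc_def)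
  qed
  moreover have "v \<in> sphere s u \<longleftrightarrow> (\<exists>p. p 0 = u \<and> p s = v \<and> (\<forall>i<s. (p i, p (i + 1)) \<in> E))" for v
    by (simp add: mem_sphere relpow_fun_conv)
  moreover have "p 0 = u \<and> p s = v \<and> (\<forall>i<s. (p i, p (i + 1)) \<in> E)" if "is_s_arc D s p u v" for p v
    using that by (simp add: is_s_arc_def)
  ultimately show ?thesis unfolding arc_sphere_def by blast
qed

lemma desc_conv: "u \<in> V \<Longrightarrow> desc D u = below u"
  by (simp add: desc_def arc_sphere_conv below_spheres)

lemma distance_transitiveD:
  assumes "u \<in> V" "u' \<in> V" "v \<in> sphere s u" "v' \<in> sphere s u'"
    "\<And>t. t < s \<Longrightarrow> v \<notin> sphere t u" "\<And>t. t < s \<Longrightarrow> v' \<notin> sphere t u'"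
  shows "\<exists>g. aut g \<and> g u = u' \<and> g v = v'"
proof -
  have "at_distance D s u v" "at_distance D s u' v'"
    using assms by (simp_all add: at_distance_def arc_sphere_conv)
  with dist_trans show ?thesis unfolding distance_transitive_def by blast
qed

lemma vertex_trans: "u \<in> V \<Longrightarrow> u' \<in> V \<Longrightarrow> \<exists>g. aut g \<and> g u = u'"
  using distance_transitiveD[of u u' u 0 u'] by auto

text \<open>At a minimal counterexample \<open>s\<close>, distance transitivity puts another member of
  \<open>sphere s u\<close> strictly above each member, impossible in a finite acyclic set.\<close>

lemma sphere_disjoint:
  assumes "u \<in> V" "v \<in> sphere s u" "v \<in> sphere t u" "s < t"
  shows False
  using assms
proof (induction s arbitrary: u v t rule: less_induct)
  case (less s)
  \<comment> \<open>The induction hypothesis excludes shorter walks, so \<open>s\<close> is the true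
    distance and distance transitivity applies.\<close>
  have min: "v' \<notin> sphere r u'" if "u' \<in> V" "v' \<in> sphere s u'" "r < s" for u' v' r
    using less.IH[OF that(3,1) _ that(2,3)] by blast
  \<comment> \<open>The automorphism fixing \<open>u\<close> and taking \<open>v\<close> to
    \<open>v'\<close> puts \<open>v'\<close> into \<open>sphere t u\<close> too; a walk of length
    \<open>t\<close> to \<open>v'\<close> crosses \<open>sphere s u\<close> at some
    \<open>w\<close>.\<close>
  have "\<exists>w \<in> sphere s u. (w, v') \<in> E\<^sup>+" if v': "v' \<in> sphere s u" for v'
  proof -
    obtain g where g: "aut g" "g u = u" "g v = v'"
      using distance_transitiveD[OF less.prems(1,1,2) v'] min less.prems v' by blast
    then have "v' \<in> sphere (s + (t - s)) u"
      using aut_relpow[OF g(1), of u v t] less.prems by (simp add: mem_sphere)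
    then obtain w where "w \<in> sphere s u" "v' \<in> sphere (t - s) w"
      by (rule sphere_add_obtain)
    with less.prems(4) show ?thesis
      by (auto simp: mem_sphere trancl_power intro!: bexI[of _ w] exI[of _ "t - s"])
  qed
  moreover have "\<exists>z \<in> sphere s u. \<forall>w. (w, z) \<in> E\<^sup>+ \<inter> sphere s u \<times> sphere s u \<longrightarrow> w \<notin> sphere s u"
  proof -
    have "wf (E\<^sup>+ \<inter> sphere s u \<times> sphere s u)"
    proof (rule finite_acyclic_wf)
      show "finite (E\<^sup>+ \<inter> sphere s u \<times> sphere s u)"
        using finite_sphere[OF less.prems(1)] by auto
      show "acyclic (E\<^sup>+ \<inter> sphere s u \<times> sphere s u)"
        by (rule acyclic_subset[of "E\<^sup>+"]) (use E_acyclic in \<open>auto simp: acyclic_def\<close>)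
    qed
    then show ?thesis
      using less.prems(2) unfolding wf_eq_minimal by blast
  qed
  ultimately show False by blast
qed

lemma sphere_unique:
  assumes "u \<in> V" "v \<in> sphere s u" "v \<in> sphere t u"
  shows "s = t"
  using sphere_disjoint[OF assms] sphere_disjoint[OF assms(1,3,2)]
  by (cases s t rule: linorder_cases) auto

text \<open>By disjointness of spheres, the length of any walk is the distance of its ends, so no
  minimality has to be assumed.\<close>

lemma sphere_transitive:
  assumes "u \<in> V" "u' \<in> V" "v \<in> sphere n u" "v' \<in> sphere n u'"
  shows "\<exists>g. aut g \<and> g u = u' \<and> g v = v'"
proof (rule distance_transitiveD[OF assms])
  show "v \<notin> sphere t u" if "t < n" for t
    using sphere_unique[OF assms(1,3), of t] that by blast
  show "v' \<notin> sphere t u'" if "t < n" for t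
    using sphere_unique[OF assms(2,4), of t] that by blast
qed

lemma card_sphere:
  assumes "u \<in> V" "u' \<in> V"
  shows "card (sphere n u) = card (sphere n u')"
proof -
  obtain g where "aut g" "g u = u'" using vertex_trans assms by blast
  then have "sphere n u' = g ` sphere n u" "inj_on g (sphere n u)"
    using aut_sphere[of g u] assms aut_inj sphere_V[of u n] inj_on_subset by blast+
  then show ?thesis by (simp add: card_image)
qed

lemma card_sphere_pos: "u \<in> V \<Longrightarrow> card (sphere n u) > 0"
  using finite_sphere sphere_nonempty by (simp add: card_gt_0_iff)

subsection \<open>In-degrees within descendant sets\<close>

definition parents :: "nat \<Rightarrow> 'a \<Rightarrow> 'a \<Rightarrow> 'a set" where
  "parents n u v = {w \<in> sphere n u. (w, v) \<in> E}"

text \<open>All candidates for the choice agree, by \<open>card_parents\<close>.\<close>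

definition indeg :: "nat \<Rightarrow> nat" where
  "indeg n = (SOME d. \<exists>u\<in>V. \<exists>v\<in>sphere (Suc n) u. d = card (parents n u v))"

lemma finite_parents: "u \<in> V \<Longrightarrow> finite (parents n u v)"
  using finite_sphere by (simp add: parents_def)

lemma card_parents:
  assumes "u \<in> V" "v \<in> sphere (Suc n) u"
  shows "card (parents n u v) = indeg n"
proof -
  have "\<exists>d. \<exists>u\<in>V. \<exists>v\<in>sphere (Suc n) u. d = card (parents n u v)"
    using assms by blast
  from someI_ex[OF this, folded indeg_def] obtain u' v' where
    u': "u' \<in> V" "v' \<in> sphere (Suc n) u'" "indeg n = card (parents n u' v')"
    by blast
  obtain g where g: "aut g" "g u = u'" "g v = v'"
    using sphere_transitive[OF assms(1) u'(1) assms(2) u'(2)] by blast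
  have V: "v \<in> V" "sphere n u \<subseteq> V" using assms sphere_V by blast+
  have "parents n u' v' = g ` parents n u v"
  proof -
    have "sphere n u' = g ` sphere n u" using aut_sphere[OF g(1) assms(1)] g(2) by simp
    moreover have "(g w, v') \<in> E \<longleftrightarrow> (w, v) \<in> E" if "w \<in> sphere n u" for w
      using g(1,3) V that unfolding is_isomorphism_def by blast
    ultimately show ?thesis by (auto simp: parents_def)
  qed
  moreover have "inj_on g (parents n u v)"
    using aut_inj[OF g(1)] by (rule inj_on_subset) (use V(2) in \<open>auto simp: parents_def\<close>)
  ultimately show ?thesis by (simp add: u'(3) card_image)
qed

text \<open>Double counting of the edges between two consecutive spheres.\<close>

lemma card_sphere_indeg:
  assumes "u \<in> V"
  shows "card (sphere n u) * m = indeg n * card (sphere (Suc n) u)"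
proof -
  have "{v \<in> sphere (Suc n) u. (w, v) \<in> E} = E `` {w}" if "w \<in> sphere n u" for w
    using that by (auto simp: sphere_Suc)
  then have "(\<Sum>w\<in>sphere n u. card {v \<in> sphere (Suc n) u. (w, v) \<in> E}) = card (sphere n u) * m"
    using card_out sphere_V[OF assms] by (simp add: subset_iff)
  moreover have "(\<Sum>w\<in>sphere n u. card {v \<in> sphere (Suc n) u. (w, v) \<in> E})
      = indeg n * card (sphere (Suc n) u)"
    using card_parents[OF assms] finite_sphere[OF assms]
    by (intro sum_multicount) (auto simp: parents_def)
  ultimately show ?thesis by simp
qed

lemma parents_mono:
  assumes "(u, x) \<in> E"
  shows "parents n x v \<subseteq> parents (Suc n) u v"
  using sphere_sphere[of x "Suc 0" u n] assms by (auto simp: parents_def sphere_Suc_0)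

text \<open>Parents of \<open>v\<close> below \<open>x\<close> are also parents of \<open>v\<close>
  below an in-neighbour \<open>u\<close> of \<open>x\<close>, one level deeper.\<close>

lemma indeg_Suc:
  assumes u: "u \<in> V"
  shows "indeg n \<le> indeg (Suc n)"
proof -
  obtain x where x: "(u, x) \<in> E" using ex_out[OF u] by blast
  then have "x \<in> V" using E_V[OF x] by blast
  then obtain v where v: "v \<in> sphere (Suc n) x" using sphere_nonempty[of x "Suc n"] by blast
  then have "v \<in> sphere (Suc (Suc n)) u"
    using sphere_sphere[of x "Suc 0" u "Suc n"] x by (auto simp: sphere_Suc_0)
  then show ?thesis
    using card_parents[OF \<open>x \<in> V\<close> v] card_parents[OF u, of v "Suc n"]
      card_mono[OF finite_parents[OF u] parents_mono[OF x, of n v]] by simp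
qed

lemma indeg_mono: "u \<in> V \<Longrightarrow> i \<le> j \<Longrightarrow> indeg i \<le> indeg j"
  using lift_Suc_mono_le[of indeg i j] indeg_Suc[of u] by blast

section \<open>A level function when spheres stop growing\<close>

lemma ex_in:
  assumes "v \<in> V"
  shows "\<exists>w. (w, v) \<in> E"
proof -
  obtain w where w: "(v, w) \<in> E" using ex_out[OF assms] by blast
  then obtain g where "aut g" "g w = v" using vertex_trans[of w v] E_V[OF w] assms by blast
  with aut_E[OF _ w] show ?thesis by auto
qed

lemma connected_induct [consumes 2, case_names base fwd bwd]:
  assumes "u \<in> V" "v \<in> V"
    and "P u"
    and "\<And>x y. (x, y) \<in> E \<Longrightarrow> P x \<Longrightarrow> P y"
    and "\<And>x y. (x, y) \<in> E \<Longrightarrow> P y \<Longrightarrow> P x"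
  shows "P v"
  using connected_rtrancl[OF assms(1,2)]
proof (induction rule: rtrancl_induct)
  case (step y z)
  then show ?case using assms(4)[of y z] assms(5)[of z y] by blast
qed (rule assms(3))

text \<open>By the edge count, a sphere that does not grow has in-degree at least \<open>m\<close>.
  This persists by monotonicity, so sizes never increase again and become constant; then
  \<open>sphere k x\<close>, contained in \<open>sphere (Suc k) u\<close>, has the same
  size.\<close>

lemma sphere_Suc_eventually_eq:
  assumes a: "a \<in> V" and le: "card (sphere (Suc i) a) \<le> card (sphere i a)"
  obtains K where "\<And>u x k. (u, x) \<in> E \<Longrightarrow> k \<ge> K \<Longrightarrow> sphere (Suc k) u = sphere k x"
proof -
  have "m \<le> indeg i"
  proof (rule ccontr)
    assume "\<not> m \<le> indeg i"
    then have "indeg i * card (sphere (Suc i) a) < m * card (sphere (Suc i) a)"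
      using card_sphere_pos[OF a] by simp
    also have "\<dots> \<le> card (sphere i a) * m" using le by simp
    finally show False using card_sphere_indeg[OF a, of i] by simp
  qed
  then have ge: "m \<le> indeg k" if "k \<ge> i" for k
    using indeg_mono[OF a that] by simp
  have dec: "card (sphere (Suc k) a) \<le> card (sphere k a)" if "k \<ge> i" for k
  proof -
    have "indeg k * card (sphere (Suc k) a) \<le> indeg k * card (sphere k a)"
      using card_sphere_indeg[OF a, of k] ge[OF that] by (metis mult.commute mult_le_mono1)
    then show ?thesis using ge[OF that] m_pos by simp
  qed
  have anti: "card (sphere l a) \<le> card (sphere k a)" if "i \<le> k" "k \<le> l" for k l
    using that(2)
  proof (induction l rule: dec_induct)
    case (step l)
    then show ?case using dec[of l] that(1) by simp
  qed simp
  \<comment> \<open>Sizes are minimal at depth \<open>K\<close>, hence constant from there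
    on.\<close>
  obtain K where K: "K \<ge> i" "\<And>k. k \<ge> i \<Longrightarrow> card (sphere K a) \<le> card (sphere k a)"
    using ex_has_least_nat[of "\<lambda>k. k \<ge> i" i "\<lambda>k. card (sphere k a)"] by blast
  show thesis
  proof
    fix u x k assume e: "(u, x) \<in> E" and k: "k \<ge> K"
    then have V: "u \<in> V" "x \<in> V" using E_V[OF e] by auto
    have "sphere k x \<subseteq> sphere (Suc k) u"
      using e by (auto simp: sphere_Suc')
    moreover have "card (sphere k x) = card (sphere (Suc k) u)"
      using anti[of K k] anti[of K "Suc k"] K(1) K(2)[of k] K(2)[of "Suc k"] k
        card_sphere[OF V(1) a] card_sphere[OF V(2) a] by simp
    ultimately show "sphere (Suc k) u = sphere k x"
      using card_subset_eq[OF finite_sphere[OF V(1)]] by metis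
  qed
qed

text \<open>Once spheres stop growing, all vertices share the same tail of spheres up to a shift,
  and the shift is the required level function.\<close>

lemma property_Z_if_not_growing:
  assumes a: "a \<in> V" and le: "card (sphere (Suc i) a) \<le> card (sphere i a)"
  shows "property_Z D"
proof -
  obtain K where K: "\<And>u x k. (u, x) \<in> E \<Longrightarrow> k \<ge> K \<Longrightarrow> sphere (Suc k) u = sphere k x"
    using sphere_Suc_eventually_eq[OF a le] by metis
  \<comment> \<open>\<open>z\<close> is the shift matching the tails of spheres of \<open>v\<close>
    and \<open>a\<close>. Two natural shifts \<open>p\<close> and \<open>q\<close> represent a
    possibly negative level.\<close>
  define lev where "lev v z \<longleftrightarrow> (\<exists>p q L. z = int p - int q \<and>
    (\<forall>k\<ge>L. sphere (k + p) a = sphere (k + q) v))" for v z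
  have fwd: "lev w (z + 1)" if e: "(v, w) \<in> E" and "lev v z" for v w z
  proof -
    obtain p q L where L: "z = int p - int q" "\<And>k. k \<ge> L \<Longrightarrow> sphere (k + p) a = sphere (k + q) v"
      using \<open>lev v z\<close> unfolding lev_def by blast
    have "sphere (k + Suc p) a = sphere (k + q) w" if "k \<ge> L + K" for k
      using L(2)[of "Suc k"] K[OF e, of "k + q"] that by simp
    moreover have "z + 1 = int (Suc p) - int q" using L(1) by simp
    ultimately show ?thesis unfolding lev_def by blast
  qed
  have bwd: "lev v (z - 1)" if e: "(v, w) \<in> E" and "lev w z" for v w z
  proof -
    obtain p q L where L: "z = int p - int q" "\<And>k. k \<ge> L \<Longrightarrow> sphere (k + p) a = sphere (k + q) w"
      using \<open>lev w z\<close> unfolding lev_def by blast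
    have "sphere (k + p) a = sphere (k + Suc q) v" if "k \<ge> L + K" for k
      using L(2)[of k] K[OF e, of "k + q"] that by simp
    moreover have "z - 1 = int p - int (Suc q)" using L(1) by simp
    ultimately show ?thesis unfolding lev_def by blast
  qed
  have base: "lev a 0" unfolding lev_def by (intro exI[of _ 0]) auto
  have ex: "\<exists>z. lev v z" if "v \<in> V" for v
    using a that
  proof (induction rule: connected_induct)
    case base then show ?case using \<open>lev a 0\<close> by blast
  next
    case (fwd x y) then show ?case using \<open>\<And>v w z. (v, w) \<in> E \<Longrightarrow> lev v z \<Longrightarrow> lev w (z + 1)\<close> by blast
  next
    case (bwd x y) then show ?case using \<open>\<And>v w z. (v, w) \<in> E \<Longrightarrow> lev w z \<Longrightarrow> lev v (z - 1)\<close> by blast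
  qed
  have unique: "z = z'" if z: "lev v z" and z': "lev v z'" for v z z'
  proof -
    obtain p q L where L: "z = int p - int q" "\<And>k. k \<ge> L \<Longrightarrow> sphere (k + p) a = sphere (k + q) v"
      using z unfolding lev_def by blast
    obtain p' q' L' where L': "z' = int p' - int q'"
      "\<And>k. k \<ge> L' \<Longrightarrow> sphere (k + p') a = sphere (k + q') v"
      using z' unfolding lev_def by blast
    \<comment> \<open>The two depths are chosen so that both representations refer to the same
      sphere around \<open>v\<close>.\<close>
    have "sphere (L + L' + q' + p) a = sphere (L + L' + q + p') a"
      using L(2)[of "L + L' + q'"] L'(2)[of "L + L' + q"] by (simp add: add_ac)
    moreover obtain t where "t \<in> sphere (L + L' + q' + p) a"
      using sphere_nonempty[OF a] by blast
    ultimately have "L + L' + q' + p = L + L' + q + p'"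
      using sphere_unique[OF a] by blast
    then show ?thesis using L(1) L'(1) by simp
  qed
  define f where "f v = (THE z. lev v z)" for v
  have f: "lev v z \<Longrightarrow> f v = z" for v z
    unfolding f_def using unique by blast
  \<comment> \<open>Surjectivity: every vertex has both an out-neighbour and an
    in-neighbour.\<close>
  have "\<exists>v\<in>V. lev v z" for z
  proof (induction z rule: int_induct[of _ 0])
    case base then show ?case using a \<open>lev a 0\<close> by blast
  next
    case (step1 i)
    then obtain v w where "lev v i" "(v, w) \<in> E" using ex_out by blast
    then show ?case using fwd E_V[of v w] by blast
  next
    case (step2 i)
    then obtain v w where "lev v i" "(w, v) \<in> E" using ex_in by blast
    then show ?case using bwd E_V[of w v] by blast
  qed
  then have "f ` V = UNIV" using f by (metis (no_types, lifting) UNIV_eq_I imageI)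
  moreover have "f w = f v + 1" if e: "(v, w) \<in> E" for v w
  proof -
    obtain z where "lev v z" using ex[of v] E_V[OF e] by blast
    then show ?thesis using f fwd[OF e] by metis
  qed
  ultimately show ?thesis unfolding property_Z_def by blast
qed

subsection \<open>Reachability classes\<close>

text \<open>Only walks starting with a forward edge are encoded, since reachability starts from an
  edge \<open>(x 0, x 1)\<close>.\<close>

definition alt_walk :: "nat \<Rightarrow> (nat \<Rightarrow> 'a) \<Rightarrow> bool" where
  "alt_walk n x \<longleftrightarrow> (\<forall>i<n. if even i then (x i, x (Suc i)) \<in> E else (x (Suc i), x i) \<in> E)"

lemma E_asym: "(u, v) \<in> E \<Longrightarrow> (v, u) \<notin> E"
  using E_acyclic unfolding acyclic_def by (meson r_into_trancl trancl_into_trancl)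

lemma alternating_walk_conv:
  assumes e: "(x 0, x 1) \<in> E" and n: "n \<ge> 1"
  shows "alternating_walk D n x \<longleftrightarrow> alt_walk n x"
proof
  assume w: "alternating_walk D n x"
  \<comment> \<open>The other orientation would already contain the reverse of the first
    edge.\<close>
  have nofirst: "\<not> (2 * 0 + 1 \<le> n \<longrightarrow> (x (2 * 0 + 1), x (2 * 0)) \<in> E)"
    using E_asym[OF e] n by simp
  have ev: "(1 \<le> 2 * i \<and> 2 * i \<le> n \<longrightarrow> (x (2 * i), x (2 * i - 1)) \<in> E) \<and>
           (2 * i + 1 \<le> n \<longrightarrow> (x (2 * i), x (2 * i + 1)) \<in> E)" for i
    using w nofirst unfolding alternating_walk_def by blast
  show "alt_walk n x"
    unfolding alt_walk_def
  proof (intro allI impI)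
    fix i assume i: "i < n"
    show "if even i then (x i, x (Suc i)) \<in> E else (x (Suc i), x i) \<in> E"
    proof (cases "even i")
      case True
      then obtain j where "i = 2 * j" by (elim evenE)
      with ev[of j] i True show ?thesis by simp
    next
      case False
      then obtain j where "i = 2 * j + 1" by (elim oddE)
      with ev[of "Suc j"] i False show ?thesis by simp
    qed
  qed
next
  assume w: "alt_walk n x"
  have V: "x i \<in> V" if "i \<le> n" for i
  proof (cases i)
    case 0 then show ?thesis using E_V[OF e] by simp
  next
    case (Suc j)
    then show ?thesis
      using w that E_V[of "x j" "x i"] E_V[of "x i" "x j"]
      unfolding alt_walk_def by (metis Suc_le_eq)
  qed
  have "(1 \<le> 2 * i \<and> 2 * i \<le> n \<longrightarrow> (x (2 * i), x (2 * i - 1)) \<in> E) \<and>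
           (2 * i + 1 \<le> n \<longrightarrow> (x (2 * i), x (2 * i + 1)) \<in> E)" for i
    using w[unfolded alt_walk_def, rule_format, of "2 * i - 1"]
      w[unfolded alt_walk_def, rule_format, of "2 * i"]
    by (cases i) auto
  with V show "alternating_walk D n x"
    unfolding alternating_walk_def by blast
qed

lemma reachability_conv:
  "(e, e') \<in> reachability D \<longleftrightarrow> e \<in> E \<and> e' \<in> E \<and>
    (\<exists>n x. n \<ge> 1 \<and> alt_walk n x \<and> e = (x 0, x 1) \<and> (e' = (x (n - 1), x n) \<or> e' = (x n, x (n - 1))))"
  unfolding reachability_def using alternating_walk_conv by blast

lemma reachability_refl: "e \<in> E \<Longrightarrow> (e, e) \<in> reachability D"
  unfolding reachability_conv
  by (cases e) (auto simp: alt_walk_def intro!: exI[of _ 1] exI[of _ "\<lambda>i. if i = 0 then fst e else snd e"])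

lemma alt_walk_level:
  fixes f :: "'a \<Rightarrow> int"
  assumes f: "\<And>u v. (u, v) \<in> E \<Longrightarrow> f v = f u + 1" and w: "alt_walk n x" and "i \<le> n"
  shows "f (x i) = f (x 0) + (if even i then 0 else 1)"
  using \<open>i \<le> n\<close>
proof (induction i)
  case (Suc i)
  then show ?case
    using w[unfolded alt_walk_def, rule_format, of i] f[of "x i" "x (Suc i)"] f[of "x (Suc i)" "x i"]
    by (auto split: if_splits)
qed simp

text \<open>An alternating walk starting with \<open>(a, b)\<close> stays on the levels of
  \<open>a\<close> and \<open>b\<close>, so it never reaches \<open>c\<close> one level
  further.\<close>

lemma not_universal_if_property_Z:
  assumes "property_Z D" "a \<in> V"
  shows "\<not> reachability_universal D"
proof
  assume "reachability_universal D"
  then obtain C where C: "E // reachability D = {C}"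
    by (auto simp: reachability_universal_def)
  obtain f :: "'a \<Rightarrow> int" where f: "\<And>u v. (u, v) \<in> E \<Longrightarrow> f v = f u + 1"
    using assms(1) unfolding property_Z_def by blast
  obtain b where b: "(a, b) \<in> E" using ex_out[OF assms(2)] by blast
  then obtain c where c: "(b, c) \<in> E" using ex_out[of b] E_V[OF b] by blast
  have "reachability D `` {(a, b)} \<in> E // reachability D"
    "reachability D `` {(b, c)} \<in> E // reachability D"
    using b c by (auto intro: quotientI)
  with C have "reachability D `` {(a, b)} = reachability D `` {(b, c)}" by simp
  then have "((a, b), (b, c)) \<in> reachability D" using reachability_refl[OF c] by blast
  then obtain n x where n: "n \<ge> 1" and w: "alt_walk n x" and ab: "(a, b) = (x 0, x 1)"
    and bc: "(b, c) = (x (n - 1), x n) \<or> (b, c) = (x n, x (n - 1))"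
    unfolding reachability_conv by blast
  have lev: "f (x i) \<in> {f a, f a + 1}" if "i \<le> n" for i
  proof -
    have "f (x i) = f (x 0) + (if even i then 0 else 1)"
      using f w that by (rule alt_walk_level)
    then show ?thesis using ab by simp
  qed
  have "c = x n \<or> c = x (n - 1)" using bc by auto
  then have "f c = f a \<or> f c = f a + 1" using lev[of n] lev[of "n - 1"] by auto
  moreover have "f b = f a + 1" "f c = f b + 1" using f b c by auto
  ultimately show False by linarith
qed

text \<open>The reachability classes are generated by pairs of edges sharing their tail or their head.\<close>

definition adj :: "(('a \<times> 'a) \<times> ('a \<times> 'a)) set" where
  "adj = {(e, e'). e \<in> E \<and> e' \<in> E \<and> (fst e = fst e' \<or> snd e = snd e')}"

text \<open>Odd length means that the last edge is traversed forwards, so \<open>e'\<close> appears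
  in its own orientation and the walk can be prolonged uniformly.\<close>

lemma adj_alt_walk:
  assumes "(e, e') \<in> adj\<^sup>*" "e \<in> E"
  shows "\<exists>n x. odd n \<and> alt_walk n x \<and> e = (x 0, x 1) \<and> e' = (x (n - 1), x n)"
  using assms
proof (induction rule: rtrancl_induct)
  case base
  then show ?case
    by (intro exI[of _ 1] exI[of _ "\<lambda>i. if i = 0 then fst e else snd e"]) (auto simp: alt_walk_def)
next
  case (step e1 e2)
  then obtain n x where n: "odd n" and w: "alt_walk n x" and e: "e = (x 0, x 1)" "e1 = (x (n - 1), x n)"
    by blast
  have E: "e1 \<in> E" "e2 \<in> E" "fst e1 = fst e2 \<or> snd e1 = snd e2"
    using step.hyps(2) by (auto simp: adj_def)
  define y where "y i = (if i \<le> n then x i else if i = Suc n then fst e2 else snd e2)" for i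
  \<comment> \<open>This edge is \<open>e1\<close> if the tails agree and \<open>e2\<close> if the
    heads agree. The walk goes back along it and then forward along \<open>e2\<close>.\<close>
  have "(fst e2, x n) \<in> E"
    using E e(2) by (metis fst_conv snd_conv prod.collapse)
  then have "alt_walk (Suc (Suc n)) y"
    using w n E(2) by (auto simp: alt_walk_def y_def less_Suc_eq)
  moreover have "e = (y 0, y 1)" "e2 = (y (Suc n), y (Suc (Suc n)))"
    using e n by (auto simp: y_def Suc_le_eq odd_pos)
  ultimately show ?case using n by (intro exI[of _ "Suc (Suc n)"] exI[of _ y]) auto
qed

text \<open>The edge \<open>e0\<close> ensures that there is a class at all.\<close>

lemma universalI:
  assumes "e0 \<in> E" and "\<And>e e'. e \<in> E \<Longrightarrow> e' \<in> E \<Longrightarrow> (e, e') \<in> adj\<^sup>*"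
  shows "reachability_universal D"
proof -
  have "reachability D `` {e} = E" if "e \<in> E" for e
  proof -
    have "(e, e') \<in> reachability D" if e': "e' \<in> E" for e'
    proof -
      obtain n x where "odd n" "alt_walk n x" "e = (x 0, x 1)" "e' = (x (n - 1), x n)"
        using adj_alt_walk[OF assms(2)[OF \<open>e \<in> E\<close> e'] \<open>e \<in> E\<close>] by blast
      then show ?thesis
        unfolding reachability_conv using e' \<open>e \<in> E\<close> odd_pos[of n] by (metis Suc_leI One_nat_def)
    qed
    then show ?thesis by (auto simp: reachability_conv)
  qed
  then have "E // reachability D = {E}"
    using assms(1) by (auto simp: quotient_def)
  then show ?thesis by (auto simp: reachability_universal_def)
qed

lemma adj_sym: "(e, e') \<in> adj\<^sup>* \<Longrightarrow> (e', e) \<in> adj\<^sup>*"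
proof -
  have "sym adj" by (auto simp: adj_def sym_def)
  then show "(e, e') \<in> adj\<^sup>* \<Longrightarrow> (e', e) \<in> adj\<^sup>*" using sym_rtrancl by (metis symD)
qed

lemma adj_tail: "(a, b) \<in> E \<Longrightarrow> (a, c) \<in> E \<Longrightarrow> ((a, b), (a, c)) \<in> adj\<^sup>*"
  by (auto simp: adj_def)

lemma adj_head: "(a, c) \<in> E \<Longrightarrow> (b, c) \<in> E \<Longrightarrow> ((a, c), (b, c)) \<in> adj\<^sup>*"
  by (auto simp: adj_def)

lemma aut_adj:
  assumes "aut g" "(e, e') \<in> adj\<^sup>*"
  shows "(map_prod g g e, map_prod g g e') \<in> adj\<^sup>*"
  using assms(2)
proof (induction rule: rtrancl_induct)
  case (step e1 e2)
  have "(map_prod g g e1, map_prod g g e2) \<in> adj"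
    using step.hyps(2) aut_E[OF assms(1)] by (cases e1; cases e2) (auto simp: adj_def)
  with step.IH show ?case by (rule rtrancl_into_rtrancl)
qed simp

text \<open>Vertex transitivity copies the given pair to every vertex, so any two edges sharing a
  vertex are equivalent; connectedness does the rest.\<close>

lemma universal_if_consecutive:
  assumes "((b, y), (y, c)) \<in> adj\<^sup>*" "(b, y) \<in> E" "(y, c) \<in> E"
  shows "reachability_universal D"
proof (rule universalI[OF assms(2)])
  have cons: "((p, q), (q, r)) \<in> adj\<^sup>*" if pq: "(p, q) \<in> E" "(q, r) \<in> E" for p q r
  proof -
    obtain g where g: "aut g" "g y = q"
      using vertex_trans[of y q] E_V[OF assms(2)] E_V[OF pq(1)] by blast
    have "((g b, q), (q, g c)) \<in> adj\<^sup>*" using aut_adj[OF g(1) assms(1)] g(2) by simp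
    moreover have "((p, q), (g b, q)) \<in> adj\<^sup>*" "((q, g c), (q, r)) \<in> adj\<^sup>*"
      using aut_E[OF g(1) assms(2)] aut_E[OF g(1) assms(3)] g(2) that
      by (auto intro: adj_tail adj_head)
    ultimately show ?thesis by (meson rtrancl_trans)
  qed
  have incident: "(e, e') \<in> adj\<^sup>*"
    if "e \<in> E" "e' \<in> E" "q \<in> {fst e, snd e}" "q \<in> {fst e', snd e'}" for e e' q
    using that cons adj_sym[OF cons] adj_tail adj_head by (cases e; cases e') auto
  fix e e' assume e: "e \<in> E" and e': "e' \<in> E"
  have V: "fst e \<in> V" "fst e' \<in> V" using E_V e e' by (metis prod.collapse)+
  \<comment> \<open>Induction along an undirected path: all edges at the current vertex lie in the
    class of \<open>e\<close>.\<close>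
  have "\<forall>e''\<in>E. fst e' \<in> {fst e'', snd e''} \<longrightarrow> (e, e'') \<in> adj\<^sup>*"
    using V
  proof (induction rule: connected_induct)
    case base
    then show ?case using incident[OF e, of _ "fst e"] by blast
  next
    case (fwd x y)
    then have "(e, (x, y)) \<in> adj\<^sup>*" by auto
    then show ?case using incident[OF fwd.hyps, of _ y] by (auto intro: rtrancl_trans)
  next
    case (bwd x y)
    then have "(e, (x, y)) \<in> adj\<^sup>*" by auto
    then show ?case using incident[OF bwd.hyps, of _ x] by (auto intro: rtrancl_trans)
  qed
  then show "(e, e') \<in> adj\<^sup>*" using e' by auto
qed

end


subsection \<open>Homogeneity\<close>

locale homogeneous_dag = distance_transitive_dag +
  assumes wdh: "weakly_descendant_homogeneous D"
begin

abbreviation belows :: "'a set \<Rightarrow> 'a set" where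
  "belows X \<equiv> \<Union> (below ` X)"

lemma desc_set_conv: "X \<subseteq> V \<Longrightarrow> desc_set D X = belows X"
  by (auto simp: desc_set_def desc_conv subset_iff)

lemma below_closed: "v \<in> below u \<Longrightarrow> (v, w) \<in> E \<Longrightarrow> w \<in> below u"
  by (auto simp: below_def intro: rtrancl_into_rtrancl)

text \<open>Disjoint sets closed under out-neighbours have no edges between them, in the source as
  in the image. So \<open>g\<close> and \<open>h\<close> combine to an isomorphism of descendant
  subdigraphs, to which weak homogeneity applies.\<close>

lemma glue_automorphisms:
  assumes X: "finite X" "X \<subseteq> V" and Y: "finite Y" "Y \<subseteq> V"
    and g: "aut g" and h: "aut h"
    and disj: "belows X \<inter> belows Y = {}" "belows (g ` X) \<inter> belows (h ` Y) = {}"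
  shows "\<exists>k. aut k \<and> (\<forall>x\<in>X. k x = g x) \<and> (\<forall>y\<in>Y. k y = h y)"
proof -
  define A B where "A = belows X" and "B = belows Y"
  have AV: "A \<subseteq> V" "B \<subseteq> V" using X(2) Y(2) below_V unfolding A_def B_def by blast+
  have A': "belows (g ` X) = g ` A" and B': "belows (h ` Y) = h ` B"
    using X(2) Y(2) aut_below[OF g] aut_below[OF h] by (auto simp: A_def B_def subset_iff)
  have AB: "A \<inter> B = {}" "g ` A \<inter> h ` B = {}" using disj A' B' by (simp_all add: A_def B_def)
  have clA: "w \<in> A" if "v \<in> A" "(v, w) \<in> E" for v w
    using that below_closed unfolding A_def by blast
  have clB: "w \<in> B" if "v \<in> B" "(v, w) \<in> E" for v w
    using that below_closed unfolding B_def by blast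
  have clA': "w \<in> g ` A" if "v \<in> g ` A" "(v, w) \<in> E" for v w
    using that below_closed unfolding A'[symmetric] by blast
  have clB': "w \<in> h ` B" if "v \<in> h ` B" "(v, w) \<in> E" for v w
    using that below_closed unfolding B'[symmetric] by blast
  define f where "f v = (if v \<in> A then g v else h v)" for v
  have fA: "f v = g v" if "v \<in> A" for v using that by (simp add: f_def)
  have fB: "f v = h v" if "v \<in> B" for v using that AB(1) by (auto simp: f_def)
  have gE: "(u, v) \<in> E \<longleftrightarrow> (g u, g v) \<in> E" if "u \<in> A" "v \<in> A" for u v
    using g that AV unfolding is_isomorphism_def by blast
  have hE: "(u, v) \<in> E \<longleftrightarrow> (h u, h v) \<in> E" if "u \<in> B" "v \<in> B" for u v
    using h that AV unfolding is_isomorphism_def by blast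
  have fE: "(u, v) \<in> E \<longleftrightarrow> (f u, f v) \<in> E" if "u \<in> A \<union> B" "v \<in> A \<union> B" for u v
  proof -
    consider "u \<in> A" "v \<in> A" | "u \<in> B" "v \<in> B" | "u \<in> A" "v \<in> B" | "u \<in> B" "v \<in> A"
      using \<open>u \<in> A \<union> B\<close> \<open>v \<in> A \<union> B\<close> by blast
    then show ?thesis
    proof cases
      case 1 then show ?thesis using gE fA by simp
    next
      case 2 then show ?thesis using hE fB by simp
    next
      case 3
      have "(u, v) \<notin> E" using 3 clA AB(1) by blast
      moreover have "(g u, h v) \<notin> E" using 3 clA' AB(2) by blast
      ultimately show ?thesis using 3 fA fB by simp
    next
      case 4
      have "(u, v) \<notin> E" using 4 clB AB(1) by blast
      moreover have "(h u, g v) \<notin> E" using 4 clB' AB(2) by blast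
      ultimately show ?thesis using 4 fA fB by simp
    qed
  qed
  have "bij_betw f (A \<union> B) (g ` A \<union> h ` B)"
  proof (rule bij_betw_combine)
    have "bij_betw g A (g ` A)" using aut_inj[OF g] AV(1) by (meson inj_on_subset bij_betw_imageI)
    then show "bij_betw f A (g ` A)" using fA by (simp cong: bij_betw_cong)
    have "bij_betw h B (h ` B)" using aut_inj[OF h] AV(2) by (meson inj_on_subset bij_betw_imageI)
    then show "bij_betw f B (h ` B)" using fB by (simp cong: bij_betw_cong)
  qed (rule AB(2))
  moreover have "desc_set D (X \<union> Y) = A \<union> B"
    using X Y by (simp add: desc_set_conv A_def B_def)
  moreover have GV: "g ` X \<union> h ` Y \<subseteq> V" using X(2) Y(2) aut_V[OF g] aut_V[OF h] by blast
  moreover have "desc_set D (g ` X \<union> h ` Y) = g ` A \<union> h ` B"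
    using desc_set_conv[OF GV] A' B' by (simp add: image_Un)
  moreover have "f u \<in> g ` A \<union> h ` B" if "u \<in> A \<union> B" for u
    using that fA fB by auto
  ultimately have "is_isomorphism (induced_subdigraph D (desc_set D (X \<union> Y)))
      (induced_subdigraph D (desc_set D (g ` X \<union> h ` Y))) f"
    using fE by (simp add: is_isomorphism_def induced_subdigraph_def)
  moreover have "finite (X \<union> Y)" "X \<union> Y \<subseteq> V" "finite (g ` X \<union> h ` Y)" using X Y by auto
  ultimately obtain k where k: "aut k" "\<forall>x\<in>X \<union> Y. k x = f x"
    using wdh GV unfolding weakly_descendant_homogeneous_def by meson
  have "X \<subseteq> A" "Y \<subseteq> B" using below_refl by (auto simp: A_def B_def)
  then have "\<forall>x\<in>X. k x = g x" "\<forall>y\<in>Y. k y = h y" using k(2) fA fB by (auto simp: subset_iff)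
  with k(1) show ?thesis by blast
qed

text \<open>Lets disjointness of descendant sets be tested at a fixed depth \<open>j\<close>: going
  down \<open>j\<close> steps from \<open>v\<close> gives a vertex whose walk from \<open>x\<close>
  has a point at depth \<open>j\<close>.\<close>

lemma below_deep:
  assumes "x \<in> V" "v \<in> below x"
  shows "\<exists>w\<in>sphere j x. below v \<inter> below w \<noteq> {}"
proof -
  obtain k where k: "v \<in> sphere k x" using assms(2) by (auto simp: below_spheres)
  have "v \<in> V" using assms below_V by blast
  then obtain t where t: "t \<in> sphere j v" using sphere_nonempty by blast
  then have "t \<in> sphere (j + k) x" using sphere_sphere[OF k, of j] by (auto simp: add.commute)
  then obtain w where "w \<in> sphere j x" "t \<in> sphere k w" by (rule sphere_add_obtain)
  with t show ?thesis using sphere_below by blast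
qed

lemma aut_image_disjoint:
  assumes "aut g" "A \<subseteq> V" "B \<subseteq> V" "A \<inter> B = {}"
  shows "g ` A \<inter> g ` B = {}"
  using inj_on_image_Int[OF aut_inj[OF assms(1)] assms(2,3)] assms(4) by simp

text \<open>Replacing \<open>y\<close> by an out-neighbour moves its in-edges to its out-edges,
  while homogeneity provides an automorphism fixing \<open>x\<close> which does the same.\<close>

lemma universal_if_disjoint_pair:
  assumes ax: "(a, x) \<in> E" and b: "(b, y) \<in> E" and adj: "((a, x), (b, y)) \<in> adj\<^sup>*"
    and disj: "below x \<inter> below y = {}"
  shows "reachability_universal D"
proof -
  have V: "x \<in> V" "y \<in> V" using E_V[OF ax] E_V[OF b] by auto
  obtain c where c: "(y, c) \<in> E" using ex_out[OF V(2)] by blast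
  then have "c \<in> V" using E_V[OF c] by blast
  have "below c \<subseteq> below y" using below_closed[OF below_refl c] below_mono by blast
  obtain h where h: "aut h" "h y = c" using vertex_trans V(2) \<open>c \<in> V\<close> by blast
  have "\<exists>k. aut k \<and> (\<forall>z\<in>{x}. k z = id z) \<and> (\<forall>z\<in>{y}. k z = h z)"
    by (rule glue_automorphisms[OF _ _ _ _ aut_id h(1)])
      (use V disj h(2) \<open>below c \<subseteq> below y\<close> in auto)
  then obtain k where k: "aut k" "k x = x" "k y = c" using h(2) by auto
  \<comment> \<open>The resulting chain is \<open>(b, y)\<close>, \<open>(a, x)\<close>,
    \<open>(k a, x)\<close>, \<open>(k b, c)\<close>, \<open>(y, c)\<close>.\<close>
  have "((k a, x), (k b, c)) \<in> adj\<^sup>*" using aut_adj[OF k(1) adj] k by simp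
  moreover have "((a, x), (k a, x)) \<in> adj\<^sup>*" "((k b, c), (y, c)) \<in> adj\<^sup>*"
    using aut_E[OF k(1) ax] aut_E[OF k(1) b] k c ax by (auto intro: adj_head)
  ultimately have "((b, y), (y, c)) \<in> adj\<^sup>*"
    using adj_sym[OF adj] by (meson rtrancl_trans)
  with b c show ?thesis using universal_if_consecutive by blast
qed

end

subsection \<open>Growing descendant sets\<close>

text \<open>\<open>N_pos\<close> makes \<open>growing\<close> applicable at depth
  \<open>N\<close>.\<close>

locale growing_dag = homogeneous_dag +
  fixes \<alpha> :: 'a and N :: nat
  assumes \<alpha>: "\<alpha> \<in> V"
    and growing: "\<And>i. i \<ge> 1 \<Longrightarrow> card (sphere i \<alpha>) < card (sphere (Suc i) \<alpha>)"
    and stable: "\<And>i. i \<ge> N \<Longrightarrow> indeg i = indeg N"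
    and N_pos: "N \<ge> 1"
begin

text \<open>From depth \<open>N\<close> on the in-degrees below \<open>x\<close> and below
  \<open>u\<close> agree, so the inclusion in \<open>parents_mono\<close> is an equality.\<close>

lemma parents_below_child:
  assumes e: "(u, x) \<in> E" and i: "i \<ge> N" and v: "v \<in> sphere (Suc i) x"
    and w: "w \<in> sphere (Suc i) u" "(w, v) \<in> E"
  shows "w \<in> sphere i x"
proof -
  have V: "u \<in> V" "x \<in> V" using E_V[OF e] by auto
  have "v \<in> sphere (Suc (Suc i)) u" using e v sphere_Suc'[of "Suc i" u] by blast
  then have "card (parents (Suc i) u v) = card (parents i x v)"
    using card_parents[OF V(1)] card_parents[OF V(2) v] stable[of i] stable[of "Suc i"] i by simp
  then have "parents i x v = parents (Suc i) u v"
    using card_subset_eq[OF finite_parents[OF V(1)] parents_mono[OF e]] by simp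
  moreover have "w \<in> parents (Suc i) u v" using w by (simp add: parents_def)
  ultimately have "w \<in> parents i x v" by simp
  then show ?thesis by (simp add: parents_def)
qed

text \<open>A descendant of \<open>w\<close> entering the sphere of \<open>x\<close> at the matching
  depth would force its parent into the preceding sphere of \<open>x\<close>. Other depths are
  excluded by disjointness of the spheres around \<open>u\<close>.\<close>

lemma outside_child_disjoint:
  assumes e: "(u, x) \<in> E" and w: "w \<in> sphere (Suc N) u" "w \<notin> sphere N x"
  shows "below w \<inter> below x = {}"
proof -
  have V: "u \<in> V" using E_V[OF e] by auto
  have out: "v \<in> sphere (Suc (N + n)) u \<and> v \<notin> sphere (N + n) x" if "v \<in> sphere n w" for n v
    using that
  proof (induction n arbitrary: v)
    case 0 then show ?case using w by simp
  next
    case (Suc n)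
    then obtain v' where v': "v' \<in> sphere n w" "(v', v) \<in> E" by (auto simp: sphere_Suc)
    from Suc.IH[OF v'(1)] v'(2) parents_below_child[OF e, of "N + n" v v']
    show ?case by (auto simp: sphere_Suc)
  qed
  have False if v: "v \<in> below w" "v \<in> below x" for v
  proof -
    obtain n k where nk: "v \<in> sphere n w" "v \<in> sphere k x" using v by (auto simp: below_spheres)
    have "v \<in> sphere (Suc k) u" using nk(2) e sphere_Suc'[of k u] by blast
    then have "k = N + n" using sphere_unique[OF V] out[OF nk(1)] by blast
    then show False using nk(2) out[OF nk(1)] by simp
  qed
  then show ?thesis by blast
qed

lemma growing_V: "u \<in> V \<Longrightarrow> i \<ge> 1 \<Longrightarrow> card (sphere i u) < card (sphere (Suc i) u)"
  using growing[of i] card_sphere[OF \<alpha>] by metis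

lemma ex_outside_child:
  assumes e: "(u, x) \<in> E"
  shows "\<exists>w. w \<in> sphere (Suc N) u \<and> w \<notin> sphere N x"
proof (rule ccontr)
  assume "\<not> ?thesis"
  then have "sphere (Suc N) u \<subseteq> sphere N x" by blast
  then have "card (sphere (Suc N) u) \<le> card (sphere N u)"
    using card_mono[OF finite_sphere] card_sphere[of x u N] E_V[OF e] by metis
  with growing_V[of u N] E_V[OF e] N_pos show False by simp
qed

section \<open>Vertices with disjoint descendant sets\<close>

lemma ex_disjoint_below:
  assumes u: "u \<in> V"
  shows "\<exists>x\<in>below u. \<exists>w\<in>below u. below x \<inter> below w = {}"
proof -
  obtain x where x: "(u, x) \<in> E" using ex_out[OF u] by blast
  obtain w where w: "w \<in> sphere (Suc N) u" "w \<notin> sphere N x" using ex_outside_child[OF x] by blast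
  have "x \<in> below u" using below_closed[OF below_refl x] .
  moreover have "w \<in> below u" using w(1) sphere_below by blast
  moreover have "below x \<inter> below w = {}" using outside_child_disjoint[OF x w] by blast
  ultimately show ?thesis by blast
qed

lemma ex_disjoint:
  assumes x: "x \<in> V"
  shows "\<exists>s\<in>V. below x \<inter> below s = {}"
proof -
  obtain p q where pq: "p \<in> below x" "q \<in> below x" "below p \<inter> below q = {}"
    using ex_disjoint_below[OF x] by blast
  then have V: "p \<in> V" "q \<in> V" using below_V[OF x] by auto
  obtain g where g: "aut g" "g p = x" using vertex_trans[OF V(1) x] by blast
  have "below x \<inter> below (g q) = {}"
    using aut_below[OF g(1) V(1)] aut_below[OF g(1) V(2)] g(2)
      aut_image_disjoint[OF g(1) below_V[OF V(1)] below_V[OF V(2)] pq(3)] by simp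
  then show ?thesis using aut_V[OF g(1) V(2)] by blast
qed

lemma ex_disjoint_triple:
  assumes x: "x \<in> V"
  shows "\<exists>s\<in>V. \<exists>t\<in>V. below x \<inter> below s = {} \<and> below x \<inter> below t = {} \<and> below s \<inter> below t = {}"
proof -
  obtain r where r: "r \<in> V" "below x \<inter> below r = {}" using ex_disjoint[OF x] by blast
  obtain s t where st: "s \<in> below r" "t \<in> below r" "below s \<inter> below t = {}"
    using ex_disjoint_below[OF r(1)] by blast
  have "s \<in> V" "t \<in> V" using st below_V[OF r(1)] by auto
  moreover have "below s \<subseteq> below r" "below t \<subseteq> below r" using st below_mono by auto
  ultimately show ?thesis using r(2) st(3) by blast
qed

text \<open>From depth \<open>N\<close> on, \<open>x\<close> and \<open>y\<close> have only those descendants in common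
  which they share at depth \<open>N\<close>.\<close>

definition clean :: "'a \<Rightarrow> 'a \<Rightarrow> bool" where
  "clean x y \<longleftrightarrow> (\<forall>w\<in>sphere N y. w \<in> sphere N x \<or> below w \<inter> below x = {})"

lemma clean_siblings:
  assumes "(u, y) \<in> E" "(u, z) \<in> E"
  shows "clean y z"
  unfolding clean_def
proof (intro ballI)
  fix w assume "w \<in> sphere N z"
  then have "w \<in> sphere (Suc N) u" using assms(2) sphere_Suc'[of N u] by blast
  with outside_child_disjoint[OF assms(1)] show "w \<in> sphere N y \<or> below w \<inter> below y = {}" by blast
qed

text \<open>An automorphism \<open>k\<close> fixes \<open>x\<close> and moves the part
  \<open>W\<close> of \<open>sphere N y\<close> outside \<open>sphere N x\<close> below
  \<open>s\<close>. As \<open>t\<close> avoids \<open>x\<close> and \<open>s\<close>, its preimage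
  avoids \<open>x\<close> and \<open>W\<close>, hence everything below \<open>y\<close> by
  \<open>below_deep\<close>.\<close>

lemma ex_disjoint_from_clean:
  assumes x: "x \<in> V" and y: "y \<in> V" and clean: "clean x y"
  shows "\<exists>t\<in>V. below t \<inter> below x = {} \<and> below t \<inter> below y = {}"
proof -
  obtain s t where st: "s \<in> V" "t \<in> V" "below x \<inter> below s = {}" "below x \<inter> below t = {}"
    "below s \<inter> below t = {}" using ex_disjoint_triple[OF x] by blast
  define W where "W = sphere N y - sphere N x"
  have W: "finite W" "W \<subseteq> V" "belows W \<inter> below x = {}"
    using finite_sphere[OF y] sphere_V[OF y] clean by (auto simp: W_def clean_def)
  obtain h where h: "aut h" "h y = s" using vertex_trans[OF y st(1)] by blast
  have hW: "belows (h ` W) \<subseteq> below s"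
  proof -
    have "h ` W \<subseteq> below s"
      using aut_sphere[OF h(1) y, of N] h(2) sphere_below[of N s] by (auto simp: W_def)
    then show ?thesis using below_mono by blast
  qed
  have "\<exists>k. aut k \<and> (\<forall>z\<in>{x}. k z = id z) \<and> (\<forall>z\<in>W. k z = h z)"
    by (rule glue_automorphisms[OF _ _ W(1,2) aut_id h(1)]) (use x W(3) hW st(3) in auto)
  then obtain k where k: "aut k" "k x = x" "\<And>z. z \<in> W \<Longrightarrow> k z = h z" by auto
  define t' where "t' = inv_into V k t"
  have t': "t' \<in> V" "k t' = t"
    using aut_inv[OF k(1)] aut_V[OF aut_inv(1)[OF k(1)]] st(2) by (auto simp: t'_def)
  have pull: "below t' \<inter> below z = {}" if "z \<in> V" "below t \<inter> below (k z) = {}" for z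
    using aut_below[OF k(1) t'(1)] aut_below[OF k(1) that(1)] t'(2) that(2) by auto
  have 1: "below t' \<inter> below x = {}" using pull[OF x] k(2) st(4) by auto
  have 2: "below t' \<inter> below w = {}" if "w \<in> W" for w
    using pull[of w] that W(2) k(3)[OF that] hW st(5) by blast
  have "below t' \<inter> below y = {}"
  proof (rule ccontr)
    assume "below t' \<inter> below y \<noteq> {}"
    then obtain v where v: "v \<in> below t'" "v \<in> below y" by blast
    obtain w where w: "w \<in> sphere N y" "below v \<inter> below w \<noteq> {}" using below_deep[OF y v(2)] by blast
    have "below t' \<inter> below w \<noteq> {}" using w(2) below_mono[OF v(1)] by blast
    moreover have "below w \<subseteq> below x" if "w \<in> sphere N x" using that sphere_below below_mono by blast
    ultimately show False using 1 2[of w] w(1) by (auto simp: W_def)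
  qed
  with 1 t'(1) show ?thesis by blast
qed

text \<open>A sibling of \<open>y\<close>, moved by an automorphism fixing \<open>y\<close> and \<open>sphere N y\<close> so that its
  part outside \<open>y\<close> avoids \<open>x\<close>, shares less with \<open>x\<close> than \<open>y\<close> does.\<close>

lemma ex_adjacent_clean_smaller_meet:
  assumes x: "x \<in> V" and edge: "(b, y) \<in> E" and clean: "clean x y"
    and meet: "sphere N x \<inter> sphere N y \<noteq> {}"
  shows "\<exists>b' z. (b', z) \<in> E \<and> ((b, y), (b', z)) \<in> adj\<^sup>* \<and> clean x z \<and>
    sphere N x \<inter> sphere N z \<subset> sphere N x \<inter> sphere N y"
proof -
  have y: "y \<in> V" and b: "b \<in> V" using E_V[OF edge] by auto
  obtain p where p: "p \<in> sphere N x" "p \<in> sphere N y" using meet by blast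
  \<comment> \<open>Some sibling \<open>c\<close> of \<open>y\<close> misses a point
    \<open>q\<close> of \<open>sphere N y\<close>; an automorphism fixing \<open>y\<close> and
    taking \<open>q\<close> to \<open>p\<close> gives a sibling missing \<open>p\<close>.\<close>
  obtain u z where uz: "(u, y) \<in> E" "(u, z) \<in> E" "p \<notin> sphere N z"
  proof -
    obtain w where w: "w \<in> sphere (Suc N) b" "w \<notin> sphere N y" using ex_outside_child[OF edge] by blast
    then obtain c where c: "(b, c) \<in> E" "w \<in> sphere N c" by (auto simp: sphere_Suc')
    then have cV: "c \<in> V" using E_V[OF c(1)] by blast
    \<comment> \<open>Spheres of equal depth have equal size, so inclusion would be equality, which
      \<open>w\<close> refutes.\<close>
    have "\<not> sphere N y \<subseteq> sphere N c"
    proof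
      assume "sphere N y \<subseteq> sphere N c"
      then have "sphere N y = sphere N c"
        using card_subset_eq[OF finite_sphere[OF cV]] card_sphere[OF y cV] by blast
      with c(2) w(2) show False by simp
    qed
    then obtain q where q: "q \<in> sphere N y" "q \<notin> sphere N c" by blast
    obtain g where g: "aut g" "g y = y" "g q = p" using sphere_transitive[OF y y q(1) p(2)] by blast
    have "p \<notin> sphere N (g c)"
    proof
      assume "p \<in> sphere N (g c)"
      then obtain q' where q': "q' \<in> sphere N c" "g q' = g q"
        using aut_sphere[OF g(1) cV] g(3) by auto
      then have "q' = q"
        using inj_onD[OF aut_inj[OF g(1)]] sphere_V[OF cV] sphere_V[OF y] q(1) by blast
      with q' q show False by simp
    qed
    then show thesis
      using that[of "g b" "g c"] aut_E[OF g(1) edge] aut_E[OF g(1) c(1)] g(2) by simp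
  qed
  have u: "u \<in> V" and z: "z \<in> V" using E_V[OF uz(2)] by auto
  obtain t where t: "t \<in> V" "below t \<inter> below x = {}" "below t \<inter> below y = {}"
    using ex_disjoint_from_clean[OF x y clean] by blast
  obtain h where h: "aut h" "h u = t" using vertex_trans[OF u t(1)] by blast
  \<comment> \<open>Fixing \<open>y\<close> keeps \<open>(k u, y)\<close> an edge; fixing
    \<open>sphere N y\<close> leaves the points that \<open>z\<close> shares with \<open>y\<close>
    in place.\<close>
  define X where "X = insert y (sphere N y)"
  define Y where "Y = sphere N z - sphere N y"
  have X: "finite X" "X \<subseteq> V" using y finite_sphere sphere_V[OF y] by (auto simp: X_def)
  have Y: "finite Y" "Y \<subseteq> V" using finite_sphere[OF z] sphere_V[OF z] by (auto simp: Y_def)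
  have bX: "belows X = below y" using sphere_below below_mono by (fastforce simp: X_def)
  have bY: "belows Y \<inter> below y = {}"
    using clean_siblings[OF uz(1,2)] by (auto simp: Y_def clean_def)
  \<comment> \<open>\<open>Y\<close> lies below \<open>u\<close>, which \<open>h\<close> moves to
    \<open>t\<close>, so its image avoids both \<open>x\<close> and \<open>y\<close>.\<close>
  have hY: "belows (h ` Y) \<subseteq> below t"
  proof -
    have "Y \<subseteq> below u"
      using uz(2) sphere_Suc'[of N u] sphere_below[of "Suc N" u] by (auto simp: Y_def)
    then have "h ` Y \<subseteq> below t" using aut_below[OF h(1) u] h(2) by auto
    then show ?thesis using below_mono by blast
  qed
  have "\<exists>k. aut k \<and> (\<forall>v\<in>X. k v = id v) \<and> (\<forall>v\<in>Y. k v = h v)"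
  proof (rule glue_automorphisms[OF X Y aut_id h(1)])
    show "belows X \<inter> belows Y = {}" using bX bY by blast
    show "belows (id ` X) \<inter> belows (h ` Y) = {}" using bX hY t(3) by auto
  qed
  then obtain k where k: "aut k" "\<And>v. v \<in> X \<Longrightarrow> k v = v" "\<And>v. v \<in> Y \<Longrightarrow> k v = h v" by auto
  have ky: "k y = y" using k(2) by (simp add: X_def)
  \<comment> \<open>Points of \<open>sphere N (k z)\<close> either come from \<open>Y\<close> and
    avoid \<open>x\<close>, or were fixed and already belonged to both \<open>z\<close> and
    \<open>y\<close>.\<close>
  have k_split: "(v \<in> sphere N z \<and> v \<in> sphere N y) \<or> below v \<inter> below x = {}"
    if v: "v \<in> sphere N (k z)" for v
  proof -
    obtain v0 where v0: "v0 \<in> sphere N z" "v = k v0" using v aut_sphere[OF k(1) z] by auto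
    show ?thesis
    proof (cases "v0 \<in> sphere N y")
      case True
      then have "v = v0" using k(2) v0(2) by (simp add: X_def)
      with True v0(1) show ?thesis by blast
    next
      case False
      then have "v0 \<in> Y" using v0(1) by (simp add: Y_def)
      then have "below v \<subseteq> below t" using k(3) v0(2) hY by auto
      with t(2) show ?thesis by blast
    qed
  qed
  have in_x: "v \<notin> sphere N x" if "below v \<inter> below x = {}" for v
    using that below_refl[of v] sphere_below[of N x] by blast
  have "(k u, k z) \<in> E" "(k u, y) \<in> E" using aut_E[OF k(1) uz(2)] aut_E[OF k(1) uz(1)] ky by auto
  then have "((b, y), (k u, k z)) \<in> adj\<^sup>*"
    using adj_head[OF edge, of "k u"] adj_tail[of "k u" y "k z"] by (meson rtrancl_trans)
  moreover have "clean x (k z)"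
    using k_split clean unfolding clean_def by blast
  moreover have "sphere N x \<inter> sphere N (k z) \<subseteq> sphere N x \<inter> sphere N y"
    using k_split in_x by blast
  moreover have "p \<notin> sphere N (k z)" using k_split[of p] in_x[of p] p(1) uz(3) by blast
  ultimately show ?thesis using \<open>(k u, k z) \<in> E\<close> p by blast
qed

text \<open>Descent on the overlap at depth \<open>N\<close>, starting from the pair \<alpha>,
  \<alpha>, which is trivially \<open>clean\<close>. Once the overlap is empty, cleanness makes the
  descendant sets disjoint.\<close>

lemma universal_if_growing: "reachability_universal D"
proof -
  obtain a where a: "(a, \<alpha>) \<in> E" using ex_in[OF \<alpha>] by blast
  have descent: "\<exists>b' z. (b', z) \<in> E \<and> ((a, \<alpha>), (b', z)) \<in> adj\<^sup>* \<and> clean \<alpha> z \<and>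
      sphere N \<alpha> \<inter> sphere N z = {}"
    if "(b, y) \<in> E" "((a, \<alpha>), (b, y)) \<in> adj\<^sup>*" "clean \<alpha> y" for b y
    using that
  proof (induction "card (sphere N \<alpha> \<inter> sphere N y)" arbitrary: b y rule: less_induct)
    case less
    show ?case
    proof (cases "sphere N \<alpha> \<inter> sphere N y = {}")
      case True
      then show ?thesis using less.prems by blast
    next
      case False
      obtain b' z where z: "(b', z) \<in> E" "((b, y), (b', z)) \<in> adj\<^sup>*" "clean \<alpha> z"
        "sphere N \<alpha> \<inter> sphere N z \<subset> sphere N \<alpha> \<inter> sphere N y"
        using ex_adjacent_clean_smaller_meet[OF \<alpha> less.prems(1,3) False] by blast
      have "card (sphere N \<alpha> \<inter> sphere N z) < card (sphere N \<alpha> \<inter> sphere N y)"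
        using z(4) finite_sphere[OF \<alpha>] by (intro psubset_card_mono) auto
      from less.hyps[OF this z(1) rtrancl_trans[OF less.prems(2) z(2)] z(3)] show ?thesis .
    qed
  qed
  have "clean \<alpha> \<alpha>" by (simp add: clean_def)
  then obtain b z where z: "(b, z) \<in> E" "((a, \<alpha>), (b, z)) \<in> adj\<^sup>*" "clean \<alpha> z"
    "sphere N \<alpha> \<inter> sphere N z = {}"
    using descent[OF a] by blast
  have "below \<alpha> \<inter> below z = {}"
  proof (rule ccontr)
    assume "below \<alpha> \<inter> below z \<noteq> {}"
    then obtain v where v: "v \<in> below \<alpha>" "v \<in> below z" by blast
    obtain w where w: "w \<in> sphere N z" "below v \<inter> below w \<noteq> {}"
      using below_deep[of z v] v(2) E_V[OF z(1)] by blast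
    then have "below w \<inter> below \<alpha> = {}" using z(3,4) unfolding clean_def by blast
    with w(2) below_mono[OF v(1)] show False by blast
  qed
  then show ?thesis using universal_if_disjoint_pair[OF a z(1,2)] by blast
qed

end

section \<open>The cycle of implications between the three conditions\<close>

theorem theorem1p3:
  fixes D :: "'a pair_pre_digraph" and m :: nat and \<alpha> :: 'a
  assumes "pair_loopfree_digraph D"
    and "infinite (pverts D)"
    and "Digraph_Component.connected (with_proj D)"
    and "distance_transitive D"
    and "weakly_descendant_homogeneous D"
    and "m > 0"
    and "\<forall>v\<in>pverts D. finite (out_arcs (with_proj D) v) \<and> out_degree (with_proj D) v = m"
    and "\<not> has_directed_cycle D"
    and "\<alpha> \<in> pverts D"
  shows "(property_Z D \<longleftrightarrow> \<not> reachability_universal D) \<and>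
         (\<not> reachability_universal D \<longleftrightarrow> \<not> P3 (descendant_subdigraph D \<alpha>) \<alpha>)"
proof -
  interpret homogeneous_dag D m
    using assms by (auto simp: homogeneous_dag_def homogeneous_dag_axioms_def
        distance_transitive_dag_def pair_loopfree_digraph_def)
  have P3_conv: "P3 (descendant_subdigraph D \<alpha>) \<alpha> \<longleftrightarrow>
      (\<forall>i\<ge>1. card (sphere i \<alpha>) < card (sphere (Suc i) \<alpha>))"
    using assms(9) by (simp add: P3_def arc_sphere_descendant_subdigraph arc_sphere_conv)
  have "reachability_universal D" if P3: "P3 (descendant_subdigraph D \<alpha>) \<alpha>"
  proof -
    have grow: "card (sphere i \<alpha>) < card (sphere (Suc i) \<alpha>)" if "i \<ge> 1" for i
      using P3 that by (simp add: P3_conv)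
    \<comment> \<open>A larger in-degree on a larger next sphere would need more edges than the
      \<open>m\<close> leaving each vertex provide.\<close>
    have "indeg i \<le> m" if "i \<ge> 1" for i
    proof (rule ccontr)
      assume "\<not> indeg i \<le> m"
      then have "card (sphere i \<alpha>) * m < card (sphere (Suc i) \<alpha>) * indeg i"
        using grow[OF that] by (intro mult_strict_mono) auto
      with card_sphere_indeg[OF assms(9), of i] show False by (simp add: mult.commute)
    qed
    \<comment> \<open>\<open>N\<close> is where the bounded in-degree attains its maximum;
      monotonicity then keeps it constant.\<close>
    then obtain N where N: "N \<ge> 1" "\<And>i. i \<ge> 1 \<Longrightarrow> indeg i \<le> indeg N"
      using ex_has_greatest_nat[of "\<lambda>i. i \<ge> 1" 1 indeg "Suc m"] by (auto simp: less_Suc_eq_le)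
    interpret growing_dag D m \<alpha> N
    proof unfold_locales
      show "indeg i = indeg N" if "i \<ge> N" for i
        using N(2)[of i] N(1) indeg_mono[OF assms(9) that] that by simp
    qed (use assms(9) grow N(1) in auto)
    show ?thesis by (rule universal_if_growing)
  qed
  moreover have "property_Z D" if "\<not> P3 (descendant_subdigraph D \<alpha>) \<alpha>"
    using that property_Z_if_not_growing[OF assms(9)] by (auto simp: P3_conv not_less)
  moreover have "\<not> reachability_universal D" if "property_Z D"
    using not_universal_if_property_Z[OF that assms(9)] .
  ultimately show ?thesis by blast
qed

end
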